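(* Let $(X,d)$ be an ultrametric space. Then the following statements are equivalent: (1) The set $\bar{\mathbf{B}}_X^0$ is countable. (2) The space $(\bar{\mathbf{B}}_X, d_H)$ is separable.
   Context: Metric spaces are nonempty. An ultrametric space is a metric space $(X,d)$ with $d(x,y)\le\max\{d(x,z),d(z,y)\}$ for all $x,y,z\in X$. For $c\in X$ and $r\ge 0$ the closed ball is $\bar B_r(c)=\{x\in X: d(c,x)\le r\}$ (so $\bar B_0(c)=\{c\}$). $\bar{\mathbf{B}}_X$ is the set of all closed balls $\bar B_r(c)$, $c\in X$, $r\ge 0$, regarded as subsets of $X$, and $\bar{\mathbf{B}}_X^0$ is the set of all subsets of $X$ that can be written as $\bar B_r(c)$ with $c\in X$ and $r>0$. The Hausdorff distance between nonempty closed bounded sets $A,B\subseteq X$ is $d_H(A,B)=\max\{\sup_{a\in A}\inf_{b\in B}d(a,b),\ \sup_{b\in B}\inf_{a\in A}d(a,b)\}$; $\bar{\mathbf{B}}_X$ is equipped with the metric $d_H$. "Countable" means finite or countably infinite; a metric space is separable if it contains a countable dense subset. *)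

theory Defs
  imports "HOL-Analysis.Abstract_Metric_Spaces"
begin

locale Ultrametric_space = Metric_space +
  assumes nonempty: "M \<noteq> {}"
    and ultrametric:
      "\<And>x y z. \<lbrakk>x \<in> M; y \<in> M; z \<in> M\<rbrakk> \<Longrightarrow> d x y \<le> max (d x z) (d z y)"

context Metric_space
begin

definition closed_balls :: "'a set set"
  where "closed_balls = {mcball c r | c r. c \<in> M \<and> 0 \<le> r}"

text \<open>A subset belongs to this collection as soon as one of its representations has a positive
  radius; in particular, so do the singletons of isolated points.\<close>

definition closed_balls_pos :: "'a set set"
  where "closed_balls_pos = {mcball c r | c r. c \<in> M \<and> 0 < r}"

definition closed_bounded_sets :: "'a set set"
  where "closed_bounded_sets = {A. A \<noteq> {} \<and> closedin mtopology A \<and> mbounded A}"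

text \<open>The value \<open>0\<close> outside \<^const>\<open>closed_bounded_sets\<close> is a convention: the locale
  \<^locale>\<open>Metric_space\<close> requires distance functions to be nonnegative on the whole type.\<close>

definition hausdorff_dist :: "'a set \<Rightarrow> 'a set \<Rightarrow> real"
  where "hausdorff_dist A B =
    (if A \<in> closed_bounded_sets \<and> B \<in> closed_bounded_sets
     then max (SUP a\<in>A. INF b\<in>B. d a b) (SUP b\<in>B. INF a\<in>A. d a b)
     else 0)"

lemma closed_balls_subset: "closed_balls \<subseteq> closed_bounded_sets"
  by (auto simp: closed_balls_def closed_bounded_sets_def mbounded_mcball mcball_eq_empty
      simp del: in_mcball)

lemma closed_bounded_setsD:
  assumes "A \<in> closed_bounded_sets"
  shows "A \<noteq> {}" "A \<subseteq> M" "closedin mtopology A" "mbounded A"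
  using assms mbounded_subset_mspace[of A] by (simp_all add: closed_bounded_sets_def)

lemma bdd_below_dist [simp]: "bdd_below (d a ` B)" "bdd_below ((\<lambda>a. d a b) ` B)"
  by (auto intro!: bdd_belowI[of _ 0])

lemma bdd_above_INF_dist:
  assumes "A \<in> closed_bounded_sets" "B \<in> closed_bounded_sets"
  shows "bdd_above ((\<lambda>a. INF b\<in>B. d a b) ` A)"
proof -
  obtain b where b: "b \<in> B" "b \<in> M"
    using closed_bounded_setsD(1,2)[OF assms(2)] by blast
  obtain x r where A: "A \<subseteq> mcball x r"
    using assms(1) by (auto simp: closed_bounded_sets_def mbounded_def)
  show ?thesis
  proof (rule bdd_aboveI2)
    fix a assume "a \<in> A"
    then have "d x a \<le> r" "x \<in> M" "a \<in> M"
      using A by auto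
    then have "d a b \<le> r + d x b"
      using triangle[of a x b] b commute[of a x] by auto
    moreover have "(INF b\<in>B. d a b) \<le> d a b"
      by (rule cINF_lower) (use b in auto)
    ultimately show "(INF b\<in>B. d a b) \<le> r + d x b"
      by linarith
  qed
qed

lemma SUP_INF_dist_triangle:
  assumes A: "A \<in> closed_bounded_sets" and B: "B \<in> closed_bounded_sets"
    and C: "C \<in> closed_bounded_sets"
  shows "(SUP a\<in>A. INF c\<in>C. d a c) \<le> (SUP a\<in>A. INF b\<in>B. d a b) + (SUP b\<in>B. INF c\<in>C. d b c)"
proof (rule cSUP_least)
  have ne: "A \<noteq> {}" "B \<noteq> {}" "C \<noteq> {}" and sub: "A \<subseteq> M" "B \<subseteq> M" "C \<subseteq> M"
    using closed_bounded_setsD(1,2) A B C by simp_all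
  then show "A \<noteq> {}" by simp
  fix a assume a: "a \<in> A"
  let ?S = "SUP b\<in>B. INF c\<in>C. d b c"
  have "(INF c\<in>C. d a c) - ?S \<le> d a b" if b: "b \<in> B" for b
  proof -
    have "(INF c\<in>C. d a c) - d a b \<le> (INF c\<in>C. d b c)"
    proof (rule cINF_greatest)
      fix c assume c: "c \<in> C"
      have "(INF c\<in>C. d a c) \<le> d a c"
        by (rule cINF_lower) (use c in auto)
      also have "\<dots> \<le> d a b + d b c"
        using triangle a b c sub by blast
      finally show "(INF c\<in>C. d a c) - d a b \<le> d b c"
        by simp
    qed (use ne in auto)
    also have "\<dots> \<le> ?S"
      by (rule cSUP_upper[OF b bdd_above_INF_dist[OF B C]])
    finally show ?thesis
      by simp
  qed
  then have "(INF c\<in>C. d a c) - ?S \<le> (INF b\<in>B. d a b)"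
    using ne by (intro cINF_greatest)
  also have "\<dots> \<le> (SUP a\<in>A. INF b\<in>B. d a b)"
    by (rule cSUP_upper[OF a bdd_above_INF_dist[OF A B]])
  finally show "(INF c\<in>C. d a c) \<le> (SUP a\<in>A. INF b\<in>B. d a b) + ?S"
    by simp
qed

lemma SUP_INF_dist_nonneg:
  assumes "A \<in> closed_bounded_sets" "B \<in> closed_bounded_sets"
  shows "0 \<le> (SUP a\<in>A. INF b\<in>B. d a b)"
proof -
  obtain a where a: "a \<in> A"
    using assms(1) by (auto simp: closed_bounded_sets_def)
  have "0 \<le> (INF b\<in>B. d a b)"
    using assms(2) by (intro cINF_greatest) (auto simp: closed_bounded_sets_def)
  also have "\<dots> \<le> (SUP a\<in>A. INF b\<in>B. d a b)"
    by (rule cSUP_upper[OF a bdd_above_INF_dist[OF assms]])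
  finally show ?thesis .
qed

lemma SUP_INF_dist_le_0_imp_subset:
  assumes A: "A \<in> closed_bounded_sets" and B: "B \<in> closed_bounded_sets"
    and le: "(SUP a\<in>A. INF b\<in>B. d a b) \<le> 0"
  shows "A \<subseteq> B"
proof
  fix a assume a: "a \<in> A"
  have BM: "B \<subseteq> M" and "a \<in> M" and ne: "B \<noteq> {}" and cl: "closedin mtopology B"
    using closed_bounded_setsD(1-3)[OF B] closed_bounded_setsD(2)[OF A] a by (simp_all add: subsetD)
  have "(INF b\<in>B. d a b) \<le> 0"
    using cSUP_upper[OF a bdd_above_INF_dist[OF A B]] le by linarith
  then have "\<exists>b\<in>B. d a b < e" if "0 < e" for e
    using cINF_less_iff[OF ne bdd_below_dist(1), of a e] that by simp
  then have "a \<in> mtopology closure_of B"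
    using BM \<open>a \<in> M\<close> by (simp add: metric_closure_of) (meson subsetD)
  then show "a \<in> B"
    using cl by (simp add: closure_of_closedin)
qed

lemma hausdorff_dist_eq:
  assumes "A \<in> closed_bounded_sets" "B \<in> closed_bounded_sets"
  shows "hausdorff_dist A B = max (SUP a\<in>A. INF b\<in>B. d a b) (SUP b\<in>B. INF a\<in>A. d b a)"
proof -
  have "(SUP b\<in>B. INF a\<in>A. d a b) = (SUP b\<in>B. INF a\<in>A. d b a)"
    by (intro SUP_cong INF_cong refl commute)
  with assms show ?thesis
    by (simp add: hausdorff_dist_def)
qed

lemma hausdorff_dist_self:
  assumes "A \<in> closed_bounded_sets"
  shows "hausdorff_dist A A = 0"
proof -
  have "(SUP a\<in>A. INF b\<in>A. d a b) \<le> 0"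
  proof (rule cSUP_least)
    show "A \<noteq> {}"
      using assms by (auto simp: closed_bounded_sets_def)
    fix a assume a: "a \<in> A"
    then have "a \<in> M"
      using closed_bounded_setsD(2)[OF assms] by blast
    moreover have "(INF b\<in>A. d a b) \<le> d a a"
      by (rule cINF_lower) (use a in auto)
    ultimately show "(INF b\<in>A. d a b) \<le> 0"
      by simp
  qed
  then show ?thesis
    using assms SUP_INF_dist_nonneg[OF assms assms] by (simp add: hausdorff_dist_eq)
qed

lemma Metric_space_hausdorff_dist: "Metric_space closed_bounded_sets hausdorff_dist"
proof
  fix A B C
  show "0 \<le> hausdorff_dist A B"
    using SUP_INF_dist_nonneg[of A B]
    by (cases "A \<in> closed_bounded_sets \<and> B \<in> closed_bounded_sets")
      (auto simp: hausdorff_dist_eq le_max_iff_disj, auto simp: hausdorff_dist_def)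
  show "hausdorff_dist A B = hausdorff_dist B A"
    by (cases "A \<in> closed_bounded_sets \<and> B \<in> closed_bounded_sets")
      (auto simp: hausdorff_dist_eq max.commute, auto simp: hausdorff_dist_def)
  assume A: "A \<in> closed_bounded_sets" and B: "B \<in> closed_bounded_sets"
  show "hausdorff_dist A B = 0 \<longleftrightarrow> A = B"
  proof
    assume "hausdorff_dist A B = 0"
    then have "(SUP a\<in>A. INF b\<in>B. d a b) \<le> 0" "(SUP b\<in>B. INF a\<in>A. d b a) \<le> 0"
      unfolding hausdorff_dist_eq[OF A B] by linarith+
    then show "A = B"
      using SUP_INF_dist_le_0_imp_subset A B by blast
  qed (use A hausdorff_dist_self in simp)
  assume C: "C \<in> closed_bounded_sets"
  show "hausdorff_dist A C \<le> hausdorff_dist A B + hausdorff_dist B C"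
    unfolding hausdorff_dist_eq[OF A B] hausdorff_dist_eq[OF B C] hausdorff_dist_eq[OF A C]
    using SUP_INF_dist_triangle[OF A B C] SUP_INF_dist_triangle[OF C B A] by linarith
qed

lemma Metric_space_closed_balls: "Metric_space closed_balls hausdorff_dist"
  by (rule Metric_space.subspace[OF Metric_space_hausdorff_dist closed_balls_subset])

end

end

theory Submission
  imports Defs
begin

text \<open>Distinct balls of an ultrametric space whose radii are at least some positive number are
  farther than that number from each other in the Hausdorff distance, so in the separable case
  there are only countably many of them; now exhaust the positive radii by a sequence tending to
  zero. Conversely, a ball of radius zero is the limit of the balls of positive radius with the
  same center, so the balls of positive radius are dense.\<close>

text \<open>Sending each point of \<open>S\<close> to a point of a countable dense set
  \<open>D\<close> at distance less than \<open>e / 2\<close> is injective: two points of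
  \<open>S\<close> with the same image would be less than \<open>e\<close> apart.\<close>

lemma (in Metric_space) countable_separated_subset:
  assumes sep: "separable_space mtopology" and "S \<subseteq> M" "0 < e"
    and far: "\<And>x y. \<lbrakk>x \<in> S; y \<in> S; x \<noteq> y\<rbrakk> \<Longrightarrow> e \<le> d x y"
  shows "countable S"
proof -
  obtain D where D: "countable D" "D \<subseteq> M" "mtopology closure_of D = M"
    using sep by (auto simp: separable_space_def)
  have "\<exists>y\<in>D. d x y < e / 2" if "x \<in> S" for x
  proof -
    have "x \<in> mtopology closure_of D"
      using D that \<open>S \<subseteq> M\<close> by blast
    moreover have "0 < e / 2"
      using \<open>0 < e\<close> by simp
    ultimately show ?thesis
      unfolding metric_closure_of in_mball by blast
  qed
  then obtain f where f: "\<And>x. x \<in> S \<Longrightarrow> f x \<in> D \<and> d x (f x) < e / 2"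
    by metis
  have "inj_on f S"
  proof (rule inj_onI, rule ccontr)
    fix x y assume xy: "x \<in> S" "y \<in> S" "f x = f y" "x \<noteq> y"
    have "d x y \<le> d x (f x) + d y (f y)"
      using triangle[of x "f x" y] xy f[of x] D(2) \<open>S \<subseteq> M\<close> commute[of y "f x"] by auto
    then show False
      using far[of x y] f[of x] f[of y] xy by linarith
  qed
  moreover have "f ` S \<subseteq> D"
    using f by blast
  ultimately show ?thesis
    using D(1) by (meson countable_image_inj_on countable_subset)
qed

lemma (in Metric_space) mcball_0: "c \<in> M \<Longrightarrow> mcball c 0 = {c}"
  by auto (metis mdist_pos_less not_le)

text \<open>Since \<open>c\<close> lies in the ball, the supremum over \<open>{c}\<close> is at most
  \<open>d c c = 0\<close>; the other supremum runs over the distances to \<open>c\<close> of points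
  of the ball.\<close>

lemma (in Metric_space) hausdorff_dist_singleton_mcball:
  assumes "c \<in> M" "0 \<le> r"
  shows "hausdorff_dist {c} (mcball c r) \<le> r"
proof -
  have "{c} \<in> closed_balls" "mcball c r \<in> closed_balls"
    using assms mcball_0[of c] unfolding closed_balls_def by blast+
  then have cb: "{c} \<in> closed_bounded_sets" "mcball c r \<in> closed_bounded_sets"
    using closed_balls_subset by blast+
  have c: "c \<in> mcball c r"
    using assms by simp
  have "(INF b\<in>mcball c r. d c b) \<le> d c c"
    by (rule cINF_lower[OF _ c]) simp
  moreover have "(SUP b\<in>mcball c r. INF a\<in>{c}. d b a) \<le> r"
  proof (rule cSUP_least)
    show "mcball c r \<noteq> {}"
      using c by blast
  qed (simp add: commute)
  ultimately show ?thesis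
    using assms by (simp add: hausdorff_dist_eq[OF cb])
qed

text \<open>For \<open>b\<close> in \<open>B\<close> outside the ball and \<open>a\<close> inside
  it, \<open>d c a \<le> r < d c b \<le> max (d c a) (d a b)\<close>, so the maximum must be
  \<open>d a b\<close>. Thus \<open>b\<close> is at distance at least \<open>d c b > r\<close> from
  the whole ball. Only the radius of one ball enters; \<open>B\<close> need not be a ball.\<close>

lemma (in Ultrametric_space) hausdorff_dist_mcball_gt:
  assumes "c \<in> M" "0 \<le> r" and B: "B \<in> closed_bounded_sets" and "\<not> B \<subseteq> mcball c r"
  shows "r < hausdorff_dist B (mcball c r)"
proof -
  let ?A = "mcball c r"
  have "?A \<in> closed_balls"
    using assms unfolding closed_balls_def by blast
  then have A: "?A \<in> closed_bounded_sets"
    using closed_balls_subset by blast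
  obtain b where b: "b \<in> B" "b \<notin> ?A"
    using assms by blast
  then have bM: "b \<in> M"
    using closed_bounded_setsD(2)[OF B] by blast
  then have gt: "r < d c b"
    using b assms by auto
  have "d c b \<le> (INF a\<in>?A. d b a)"
  proof (rule cINF_greatest)
    fix a assume "a \<in> ?A"
    then show "d c b \<le> d b a"
      using ultrametric[of c b a] bM \<open>c \<in> M\<close> gt by (auto simp: commute)
  qed (use assms in \<open>simp add: mcball_eq_empty\<close>)
  also have "\<dots> \<le> (SUP b\<in>B. INF a\<in>?A. d b a)"
    by (rule cSUP_upper[OF b(1) bdd_above_INF_dist[OF B A]])
  finally show ?thesis
    using gt by (simp add: hausdorff_dist_eq[OF B A])
qed

theorem theorem5p17:
  fixes M :: "'a set" and d :: "'a \<Rightarrow> 'a \<Rightarrow> real"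
  assumes "Ultrametric_space M d"
  shows "countable (Metric_space.closed_balls_pos M d) \<longleftrightarrow>
    separable_space
      (Metric_space.mtopology (Metric_space.closed_balls M d) (Metric_space.hausdorff_dist M d))"
proof -
  interpret Ultrametric_space M d by fact
  interpret H: Metric_space closed_balls hausdorff_dist
    by (rule Metric_space_closed_balls)
  have sub: "closed_balls_pos \<subseteq> closed_balls"
    unfolding closed_balls_pos_def closed_balls_def by force
  have "countable closed_balls_pos \<longleftrightarrow> separable_space H.mtopology"
  proof
    assume "countable closed_balls_pos"
    moreover have "H.mtopology closure_of closed_balls_pos = closed_balls"
    proof
      show "closed_balls \<subseteq> H.mtopology closure_of closed_balls_pos"
      proof
        fix A assume A: "A \<in> closed_balls"
        then obtain c r where cr: "A = mcball c r" "c \<in> M" "0 \<le> r"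
          unfolding closed_balls_def by blast
        have "\<exists>B\<in>closed_balls_pos. hausdorff_dist A B < e" if "0 < e" for e
        proof (cases "r = 0")
          case True
          then have "A = {c}"
            using cr by (simp add: mcball_0)
          \<comment> \<open>The radius is \<open>e / 2\<close> because the bound by the radius is
            not strict, while density asks for a distance below \<open>e\<close>.\<close>
          then have "hausdorff_dist A (mcball c (e / 2)) \<le> e / 2"
            using hausdorff_dist_singleton_mcball[of c "e / 2"] cr that by simp
          moreover have "mcball c (e / 2) \<in> closed_balls_pos"
            using cr that unfolding closed_balls_pos_def by force
          ultimately show ?thesis
            using that by force
        next
          case False
          then have "A \<in> closed_balls_pos"
            using cr unfolding closed_balls_pos_def by force
          then show ?thesis
            using A that by force
        qed
        then show "A \<in> H.mtopology closure_of closed_balls_pos"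
          unfolding H.metric_closure_of H.in_mball using A sub by blast
      qed
    qed (use closure_of_subset_topspace[of H.mtopology closed_balls_pos] in simp)
    ultimately show "separable_space H.mtopology"
      using sub by (auto simp: separable_space_def)
  next
    assume sep: "separable_space H.mtopology"
    \<comment> \<open>A set may have several centers and radii; one radius above the threshold
      suffices for membership. \<open>Suc n\<close> keeps the threshold positive at
      \<open>n = 0\<close>.\<close>
    define S where "S n = {mcball c r | c r. c \<in> M \<and> inverse (real (Suc n)) < r}" for n
    have "countable (S n)" for n
    proof (rule H.countable_separated_subset[OF sep])
      have pos: "0 < r" if "inverse (real (Suc n)) < r" for r
        using that less_trans[of 0 "inverse (real (Suc n))" r] by simp
      show "S n \<subseteq> closed_balls"
        unfolding S_def closed_balls_def using pos by force
      then have cb: "S n \<subseteq> closed_bounded_sets"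
        using closed_balls_subset by blast
      have gt: "inverse (real (Suc n)) < hausdorff_dist B A"
        if AB: "A \<in> S n" "B \<in> S n" "\<not> B \<subseteq> A" for A B
      proof -
        obtain c r where "A = mcball c r" "c \<in> M" "inverse (real (Suc n)) < r"
          using AB unfolding S_def by blast
        then show ?thesis
          using hausdorff_dist_mcball_gt[of c r B] pos[of r] AB cb by force
      qed
      \<comment> \<open>Of two distinct sets, at least one is not contained in the other, so
        \<open>gt\<close> applies in one of the two orders and symmetry of the distance covers
        both.\<close>
      show "inverse (real (Suc n)) \<le> hausdorff_dist A B" if "A \<in> S n" "B \<in> S n" "A \<noteq> B" for A B
        using gt[of A B] gt[of B A] that H.commute[of A B] by force
    qed simp
    moreover have "closed_balls_pos \<subseteq> (\<Union>n. S n)"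
    proof
      fix A assume "A \<in> closed_balls_pos"
      then obtain c r where "A = mcball c r" "c \<in> M" "0 < r"
        unfolding closed_balls_pos_def by blast
      then show "A \<in> (\<Union>n. S n)"
        using reals_Archimedean[of r] unfolding S_def by blast
    qed
    ultimately show "countable closed_balls_pos"
      by (meson countable_UN countable_subset countableI_type)
  qed
  then show ?thesis .
qed

end
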